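(* For integers $n\ge 2$ and $l\ge 1$, $$\tilde B_l(n)=\sum_{k=1}^{\Omega(n)} k!\; g_{k,l}(n),$$ where $g_{k,l}(n)$ is determined recursively, for $n\ge 2$ and $k\ge 1$, by $$g_{k,l}(n)\log n = l\sum_{\substack{d\ge 2,\ 1\le i\le k\\ d^i\mid n}} (-1)^{i+1}g_{k-i,l}(n/d^i)\log d$$ (sum over all pairs of integers $(d,i)$ satisfying the indicated conditions), with boundary conditions $g_{0,l}(1)=1$, $g_{k,l}(1)=0$ for $k\ge 1$, and $g_{0,l}(n)=0$ for $n\ge 2$.
   Context: For an integer $l\ge 1$, an $l$-colored part is a pair $(d,c)$ with $d\ge 2$ an integer (its value) and $c\in\{1,\dots,l\}$ (its color). An unordered (respectively ordered) $l$-colored factorization of an integer $n\ge 2$ is a finite multiset (respectively finite sequence) of $l$-colored parts whose values have product $n$ (one-part factorizations are included). It is called distinct if no pair $(d,c)$ occurs more than once (so parts of equal value but different color count as distinct). $\tilde B_l(n)$ is the number of distinct ordered $l$-colored factorizations of $n$. For $k \ge 1$, $g_{k,l}(n)$ is, combinatorially, the number of distinct unordered $l$-colored factorizations of $n$ with exactly $k$ parts. $\Omega(n)$ is the number of prime factors of $n$ counted with multiplicity. *)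

theory Defs
  imports Complex_Main "HOL-Library.Multiset" "HOL-Computational_Algebra.Primes"
begin

text \<open>A part is a pair (value, color).\<close>

definition colored_parts :: "nat \<Rightarrow> (nat \<times> nat) set" where
  "colored_parts l = {(d, c). 2 \<le> d \<and> c \<in> {1..l}}"

text \<open>The empty factorization is admitted below; it has product 1, so it plays no role
  for \<open>n \<ge> 2\<close>, and it realizes the boundary values of \<open>g_distinct\<close> at \<open>k = 0\<close>.\<close>

definition unordered_colored_factorizations :: "nat \<Rightarrow> nat \<Rightarrow> (nat \<times> nat) multiset set" where
  "unordered_colored_factorizations l n =
     {M. set_mset M \<subseteq> colored_parts l \<and> prod_mset (image_mset fst M) = n}"

definition ordered_colored_factorizations :: "nat \<Rightarrow> nat \<Rightarrow> (nat \<times> nat) list set" where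
  "ordered_colored_factorizations l n =
     {xs. set xs \<subseteq> colored_parts l \<and> prod_list (map fst xs) = n}"

definition B_distinct :: "nat \<Rightarrow> nat \<Rightarrow> nat" where
  "B_distinct l n = card {xs \<in> ordered_colored_factorizations l n. distinct xs}"

definition g_distinct :: "nat \<Rightarrow> nat \<Rightarrow> nat \<Rightarrow> nat" where
  "g_distinct k l n = card {M \<in> unordered_colored_factorizations l n.
                     (\<forall>p. count M p \<le> 1) \<and> size M = k}"

definition bigomega :: "nat \<Rightarrow> nat" where
  "bigomega n = size (prime_factorization n)"

text \<open>The system of equations is stated for an arbitrary real-valued \<open>h k n\<close>
  (for fixed \<open>l\<close>), so that it makes sense to ask whether it determines its solution.
  The value of \<open>h\<close> at \<open>n = 0\<close> is unconstrained and never used.\<close>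

definition g_recursion :: "nat \<Rightarrow> (nat \<Rightarrow> nat \<Rightarrow> real) \<Rightarrow> bool" where
  "g_recursion l h \<longleftrightarrow>
     h 0 1 = 1 \<and>
     (\<forall>k\<ge>1. h k 1 = 0) \<and>
     (\<forall>n\<ge>2. h 0 n = 0) \<and>
     (\<forall>n\<ge>2. \<forall>k\<ge>1.
        h k n * ln (real n) =
        real l * (\<Sum>(d, i) \<in> {(d, i). 2 \<le> d \<and> 1 \<le> i \<and> i \<le> k \<and> d ^ i dvd n}.
                    (-1) ^ (i + 1) * h (k - i) (n div d ^ i) * ln (real d)))"

end

theory Submission
  imports Defs "HOL-Combinatorics.Multiset_Permutations"
begin

text \<open>
  A distinct factorization is a finite set of colored parts, so it can be ordered in
  \<open>k!\<close> ways when it has \<open>k\<close> parts; since every part contributes at least one prime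
  factor, \<open>k \<le> \<Omega>(n)\<close>. This gives the formula for the ordered count
  (\<open>B_distinct_eq_sum_fact\<close>).

  For the recursion, write \<open>ln n\<close> as the sum of \<open>ln d\<close> over the parts \<open>(d, c)\<close> of a
  factorization \<open>S\<close> of \<open>n\<close>, and sum over all \<open>S\<close> with \<open>k\<close> parts. Exchanging the two
  summations weights \<open>ln d\<close> with the number \<open>a(k, n)\<close> of those \<open>S\<close> that contain the
  part \<open>p = (d, c)\<close>; it is \<open>0\<close> unless \<open>d\<close> divides \<open>n\<close>. Otherwise, removing \<open>p\<close> turns them into the factorizations of \<open>n / d\<close> with
  \<open>k - 1\<close> parts that avoid \<open>p\<close>, that is,
  \<open>a(k, n) = g(k - 1, n / d) - a(k - 1, n / d)\<close>. Unfolding this relation produces the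
  alternating sum over the powers \<open>d^i\<close> dividing \<open>n\<close>
  (\<open>card_factorizations_containing\<close>). This sum does not depend on the color, whence the factor
  \<open>l\<close>.

  Finally, the recursion expresses \<open>h k n\<close> through values of \<open>h\<close> at the smaller arguments
  \<open>n / d^i\<close>, and \<open>ln n \<noteq> 0\<close> for \<open>n \<ge> 2\<close>; so it has at most one solution on the
  positive integers.
\<close>

section \<open>Distinct factorizations as finite sets of parts\<close>

text \<open>Finiteness is essential: an infinite set of parts has by convention cardinality \<open>0\<close> and
  product \<open>1\<close>, and would be taken for the empty factorization.\<close>

definition distinct_factorizations :: "nat \<Rightarrow> nat \<Rightarrow> nat \<Rightarrow> (nat \<times> nat) set set" where
  "distinct_factorizations k l n =
     {S. finite S \<and> S \<subseteq> colored_parts l \<and> prod fst S = n \<and> card S = k}"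

lemma mem_distinct_factorizations_iff:
  "S \<in> distinct_factorizations k l n \<longleftrightarrow>
     finite S \<and> S \<subseteq> colored_parts l \<and> prod fst S = n \<and> card S = k"
  by (simp add: distinct_factorizations_def)

lemma g_distinct_eq_card:
  "g_distinct k l n = card (distinct_factorizations k l n)"
proof -
  let ?A = "{M \<in> unordered_colored_factorizations l n. (\<forall>p. count M p \<le> 1) \<and> size M = k}"
  have mset_set_inverse: "mset_set (set_mset M) = M" if "\<forall>p. count M p \<le> 1"
    for M :: "(nat \<times> nat) multiset"
  proof (rule multiset_eqI)
    fix p
    have "count M p = (if p \<in># M then 1 else 0)"
      using that[rule_format, of p] count_greater_zero_iff[of M p]
      by (auto simp: not_in_iff simp del: count_greater_zero_iff)
    then show "count (mset_set (set_mset M)) p = count M p"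
      by simp
  qed
  have "bij_betw mset_set (distinct_factorizations k l n) ?A"
  proof (rule bij_betwI[where g = set_mset])
    show "mset_set \<in> distinct_factorizations k l n \<rightarrow> ?A"
      by (auto simp: mem_distinct_factorizations_iff unordered_colored_factorizations_def
          prod_unfold_prod_mset count_mset_set')
    show "set_mset \<in> ?A \<rightarrow> distinct_factorizations k l n"
    proof
      fix M assume M: "M \<in> ?A"
      then have eq: "mset_set (set_mset M) = M"
        by (intro mset_set_inverse) auto
      have "size (mset_set (set_mset M)) = card (set_mset M)"
        by simp
      then show "set_mset M \<in> distinct_factorizations k l n"
        using M eq
        by (auto simp: mem_distinct_factorizations_iff unordered_colored_factorizations_def
            prod_unfold_prod_mset)
    qed
    show "set_mset (mset_set S) = S" if "S \<in> distinct_factorizations k l n" for S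
      using that by (simp add: mem_distinct_factorizations_iff)
    show "mset_set (set_mset M) = M" if "M \<in> ?A" for M
      using that mset_set_inverse by auto
  qed
  then show ?thesis
    by (simp add: g_distinct_def bij_betw_same_card)
qed

lemma part_dvd:
  assumes "S \<in> distinct_factorizations k l n" "p \<in> S"
  shows "fst p dvd n"
  using assms by (auto simp: mem_distinct_factorizations_iff)

lemma part_mem_range:
  assumes "S \<in> distinct_factorizations k l n" "n \<ge> 1" "p \<in> S"
  shows "p \<in> {2..n} \<times> {1..l}"
proof -
  have "p \<in> colored_parts l"
    using assms by (auto simp: mem_distinct_factorizations_iff)
  then show ?thesis
    using dvd_imp_le[OF part_dvd[OF assms(1,3)]] assms(2)
    by (auto simp: colored_parts_def)
qed

lemma finite_distinct_factorizations:
  assumes "n \<ge> 1"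
  shows "finite (distinct_factorizations k l n)"
proof (rule finite_subset)
  show "distinct_factorizations k l n \<subseteq> Pow ({2..n} \<times> {1..l})"
    using part_mem_range[OF _ assms] by blast
qed simp

lemma distinct_factorizations_0_1: "distinct_factorizations 0 l 1 = {{}}"
  by (auto simp: mem_distinct_factorizations_iff)

lemma distinct_factorizations_Suc_1:
  assumes "k \<ge> 1"
  shows "distinct_factorizations k l 1 = {}"
proof -
  have "S \<notin> distinct_factorizations k l 1" for S
  proof
    assume S: "S \<in> distinct_factorizations k l 1"
    then have "S \<noteq> {}"
      using assms by (auto simp: mem_distinct_factorizations_iff)
    then show False
      using part_mem_range[OF S] by auto
  qed
  then show ?thesis
    by blast
qed

lemma distinct_factorizations_0:
  assumes "n \<ge> 2"
  shows "distinct_factorizations 0 l n = {}"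
  using assms by (auto simp: mem_distinct_factorizations_iff)

section \<open>The ordered count\<close>

lemma card_le_bigomega_prod:
  assumes "finite S" "\<And>p. p \<in> S \<Longrightarrow> f p \<ge> 2"
  shows "card S \<le> bigomega (prod f S)"
  using assms
proof (induction S rule: finite_induct)
  case (insert p S)
  have "f p \<ge> 2"
    using insert.prems by simp
  then have "prime_factorization (f p) \<noteq> {#}"
    by (simp add: prime_factorization_empty_iff)
  then have "bigomega (f p) \<ge> 1"
    by (simp add: bigomega_def Suc_le_eq nonempty_has_size)
  moreover have "prod f S \<noteq> 0"
    using insert by fastforce
  then have "bigomega (f p * prod f S) = bigomega (f p) + bigomega (prod f S)"
    using \<open>f p \<ge> 2\<close> by (simp add: bigomega_def prime_factorization_mult)
  ultimately show ?case
    using insert by simp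
qed simp

lemma card_le_bigomega:
  assumes "S \<in> distinct_factorizations k l n"
  shows "k \<le> bigomega n"
proof -
  have "card S \<le> bigomega (prod fst S)"
    using assms
    by (intro card_le_bigomega_prod) (auto simp: mem_distinct_factorizations_iff colored_parts_def)
  then show ?thesis
    using assms by (simp add: mem_distinct_factorizations_iff)
qed

text \<open>The distinct ordered factorizations with underlying set \<open>S\<close> are the permutations of
  \<open>S\<close>; they are grouped by \<open>S\<close>, and the \<open>S\<close> by their cardinality.\<close>

lemma B_distinct_eq_sum_fact:
  assumes "n \<ge> 2"
  shows "B_distinct l n = (\<Sum>k = 1..bigomega n. fact k * g_distinct k l n)"
proof -
  let ?F = "\<lambda>k. distinct_factorizations k l n"
  let ?P = "\<lambda>k. \<Union>S\<in>?F k. permutations_of_set S"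
  have fin: "finite (?F k)" for k
    using assms by (intro finite_distinct_factorizations) simp
  have "{xs \<in> ordered_colored_factorizations l n. distinct xs} = (\<Union>k\<in>{1..bigomega n}. ?P k)"
    (is "?L = ?R")
  proof (intro equalityI subsetI)
    fix xs assume xs: "xs \<in> ?L"
    then have S: "set xs \<in> ?F (card (set xs))"
      by (auto simp: ordered_colored_factorizations_def mem_distinct_factorizations_iff
          prod.distinct_set_conv_list)
    then have "card (set xs) \<noteq> 0"
      using distinct_factorizations_0[OF assms, of l] by (metis empty_iff)
    then have "card (set xs) \<in> {1..bigomega n}"
      using card_le_bigomega[OF S] by (metis atLeastAtMost_iff less_one not_le)
    moreover have "xs \<in> permutations_of_set (set xs)"
      using xs by (simp add: permutations_of_set_def)
    ultimately show "xs \<in> ?R"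
      using S by blast
  next
    fix xs assume "xs \<in> ?R"
    then show "xs \<in> ?L"
      by (auto simp: ordered_colored_factorizations_def mem_distinct_factorizations_iff
          permutations_of_set_def simp flip: prod.distinct_set_conv_list)
  qed
  then have "B_distinct l n = card (\<Union>k\<in>{1..bigomega n}. ?P k)"
    by (simp add: B_distinct_def)
  also have "\<dots> = (\<Sum>k = 1..bigomega n. card (?P k))"
    using fin
    by (intro card_UN_disjoint)
       (auto simp: mem_distinct_factorizations_iff dest!: permutations_of_setD(1))
  also have "\<dots> = (\<Sum>k = 1..bigomega n. fact k * g_distinct k l n)"
  proof (rule sum.cong)
    fix k
    have "card (?P k) = (\<Sum>S\<in>?F k. card (permutations_of_set S))"
      using fin by (intro card_UN_disjoint) (auto dest: permutations_of_setD(1))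
    also have "\<dots> = (\<Sum>S\<in>?F k. fact k)"
      by (intro sum.cong) (auto simp: mem_distinct_factorizations_iff)
    finally show "card (?P k) = fact k * g_distinct k l n"
      by (simp add: g_distinct_eq_card)
  qed simp
  finally show ?thesis .
qed

section \<open>Factorizations containing a given part\<close>

text \<open>Removing the part \<open>(d, c)\<close> leaves a factorization of \<open>n / d\<close> that avoids it,
  because parts are not repeated.\<close>

lemma card_factorizations_containing_step:
  assumes p: "(d, c) \<in> colored_parts l" and "n \<ge> 1" "d dvd n"
  shows "real (card {S \<in> distinct_factorizations (Suc k) l n. (d, c) \<in> S}) =
         real (g_distinct k l (n div d)) -
         real (card {S \<in> distinct_factorizations k l (n div d). (d, c) \<in> S})"
proof -
  let ?p = "(d, c)"
  let ?F = "distinct_factorizations k l (n div d)"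
  have d: "d > 0"
    using p by (auto simp: colored_parts_def)
  have fin: "finite ?F"
    using assms d by (intro finite_distinct_factorizations) (auto elim!: dvdE)
  have "bij_betw (insert ?p) {T \<in> ?F. ?p \<notin> T}
          {S \<in> distinct_factorizations (Suc k) l n. ?p \<in> S}"
  proof (rule bij_betwI[where g = "\<lambda>S. S - {?p}"])
    show "insert ?p \<in> {T \<in> ?F. ?p \<notin> T} \<rightarrow> {S \<in> distinct_factorizations (Suc k) l n. ?p \<in> S}"
      using p \<open>d dvd n\<close> by (auto simp: mem_distinct_factorizations_iff)
    show "(\<lambda>S. S - {?p}) \<in>
        {S \<in> distinct_factorizations (Suc k) l n. ?p \<in> S} \<rightarrow> {T \<in> ?F. ?p \<notin> T}"
    proof
      fix S assume "S \<in> {S \<in> distinct_factorizations (Suc k) l n. ?p \<in> S}"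
      then have S: "finite S" "S \<subseteq> colored_parts l" "prod fst S = n" "card S = Suc k" "?p \<in> S"
        by (auto simp: mem_distinct_factorizations_iff)
      have "prod fst S = d * prod fst (S - {?p})"
        using prod.remove[OF S(1,5), of fst] by simp
      then have "prod fst (S - {?p}) = n div d"
        using S(3) d by auto
      then show "S - {?p} \<in> {T \<in> ?F. ?p \<notin> T}"
        using S by (auto simp: mem_distinct_factorizations_iff)
    qed
  qed auto
  then have "card {S \<in> distinct_factorizations (Suc k) l n. ?p \<in> S} = card {T \<in> ?F. ?p \<notin> T}"
    by (rule bij_betw_same_card[symmetric])
  moreover have "card ?F = card {T \<in> ?F. ?p \<in> T} + card {T \<in> ?F. ?p \<notin> T}"
    using fin by (subst card_Un_disjoint[symmetric]) (auto intro: arg_cong[where f = card])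
  ultimately show ?thesis
    by (simp add: g_distinct_eq_card)
qed

text \<open>Each removal of \<open>(d, c)\<close> in the previous lemma contributes one summand with alternating
  sign; the unfolding ends when no parts are left or \<open>d\<close> no longer divides the quotient.\<close>

lemma card_factorizations_containing:
  assumes p: "(d, c) \<in> colored_parts l" and "n \<ge> 1"
  shows "real (card {S \<in> distinct_factorizations k l n. (d, c) \<in> S}) =
         (\<Sum>i | 1 \<le> i \<and> i \<le> k \<and> d ^ i dvd n.
            (-1) ^ (i + 1) * real (g_distinct (k - i) l (n div d ^ i)))"
  using \<open>n \<ge> 1\<close>
proof (induction k arbitrary: n)
  case 0
  have "{S \<in> distinct_factorizations 0 l n. (d, c) \<in> S} = {}"
    by (auto simp: mem_distinct_factorizations_iff)
  moreover have "{i :: nat. 1 \<le> i \<and> i \<le> 0 \<and> d ^ i dvd n} = {}"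
    by auto
  ultimately show ?case
    by (simp only: card.empty sum.empty of_nat_0)
next
  case (Suc k)
  let ?g = "\<lambda>k m. real (g_distinct k l m)"
  show ?case
  proof (cases "d dvd n")
    case False
    have "{S \<in> distinct_factorizations (Suc k) l n. (d, c) \<in> S} = {}"
      using False part_dvd by force
    moreover have "{i. 1 \<le> i \<and> i \<le> Suc k \<and> d ^ i dvd n} = {}"
      using False dvd_trans[OF dvd_power] by fastforce
    ultimately show ?thesis
      by (simp only: card.empty sum.empty of_nat_0)
  next
    case True
    then obtain m where n: "n = d * m"
      by blast
    have d: "d > 0"
      using p by (auto simp: colored_parts_def)
    have m: "m \<ge> 1" "n div d = m"
      using n d Suc.prems by auto
    \<comment> \<open>The exponent 1 gives the term \<open>g k m\<close>; the others are shifted exponents for \<open>m\<close>.\<close>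
    have "{i. 1 \<le> i \<and> i \<le> Suc k \<and> d ^ i dvd n} =
            insert 1 (Suc ` {i. 1 \<le> i \<and> i \<le> k \<and> d ^ i dvd m})" (is "?I = insert 1 (Suc ` ?J)")
    proof (rule set_eqI)
      fix i
      show "i \<in> ?I \<longleftrightarrow> i \<in> insert 1 (Suc ` ?J)"
        using n d by (cases i) auto
    qed
    moreover have "finite ?J"
      by (rule finite_subset[of _ "{..k}"]) auto
    ultimately have "(\<Sum>i | 1 \<le> i \<and> i \<le> Suc k \<and> d ^ i dvd n.
            (-1) ^ (i + 1) * ?g (Suc k - i) (n div d ^ i)) =
          ?g k m + (\<Sum>i\<in>?J. (-1) ^ (Suc i + 1) * ?g (k - i) (n div d ^ Suc i))"
      using m by (simp add: sum.reindex image_iff)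
    also have "\<dots> = ?g k m - (\<Sum>i\<in>?J. (-1) ^ (i + 1) * ?g (k - i) (m div d ^ i))"
      using n d by (simp add: sum_negf)
    also have "\<dots> = ?g k m - real (card {S \<in> distinct_factorizations k l m. (d, c) \<in> S})"
      using Suc.IH[OF m(1)] by simp
    also have "\<dots> = real (card {S \<in> distinct_factorizations (Suc k) l n. (d, c) \<in> S})"
      using card_factorizations_containing_step[OF p Suc.prems True, of k] m by simp
    finally show ?thesis
      by simp
  qed
qed

section \<open>The recursion and its unique solution\<close>

text \<open>Both sides count the parts of all factorizations of \<open>n\<close> into \<open>k\<close> parts, with weight
  \<open>ln d\<close>: on the left factorization by factorization, on the right part by part.\<close>

lemma g_distinct_times_ln:
  assumes "n \<ge> 1"
  shows "real (g_distinct k l n) * ln (real n) =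
    real l * (\<Sum>(d, i) \<in> {(d, i). 2 \<le> d \<and> 1 \<le> i \<and> i \<le> k \<and> d ^ i dvd n}.
      (-1) ^ (i + 1) * real (g_distinct (k - i) l (n div d ^ i)) * ln (real d))"
proof -
  let ?F = "distinct_factorizations k l n"
  let ?I = "\<lambda>d. {i. 1 \<le> i \<and> i \<le> k \<and> d ^ i dvd n}"
  let ?t = "\<lambda>d i. (-1) ^ (i + 1) * real (g_distinct (k - i) l (n div d ^ i))"
  have fin: "finite ?F"
    using assms by (rule finite_distinct_factorizations)
  have ln_eq: "ln (real n) = (\<Sum>p\<in>S. ln (real (fst p)))" if "S \<in> ?F" for S
  proof -
    have "real n = (\<Prod>p\<in>S. real (fst p))" "finite S" "\<forall>p\<in>S. fst p > 0"
      using that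
      by (auto simp: mem_distinct_factorizations_iff colored_parts_def simp flip: of_nat_prod)
    then show ?thesis
      by (simp add: ln_prod)
  qed
  have "real (g_distinct k l n) * ln (real n) = (\<Sum>S\<in>?F. ln (real n))"
    by (simp add: g_distinct_eq_card)
  also have "\<dots> = (\<Sum>S\<in>?F. \<Sum>p\<in>S. ln (real (fst p)))"
    using ln_eq by (rule sum.cong[OF refl])
  also have "\<dots> = (\<Sum>S\<in>?F. \<Sum>p | p \<in> {2..n} \<times> {1..l} \<and> p \<in> S. ln (real (fst p)))"
  proof (rule sum.cong)
    fix S assume "S \<in> ?F"
    then have "S = {p. p \<in> {2..n} \<times> {1..l} \<and> p \<in> S}"
      using part_mem_range[OF _ assms] by blast
    then show "(\<Sum>p\<in>S. ln (real (fst p))) =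
        (\<Sum>p | p \<in> {2..n} \<times> {1..l} \<and> p \<in> S. ln (real (fst p)))"
      by (rule arg_cong)
  qed simp
  also have "\<dots> = (\<Sum>p\<in>{2..n} \<times> {1..l}. \<Sum>S | S \<in> ?F \<and> p \<in> S. ln (real (fst p)))"
    using fin by (intro sum.swap_restrict) auto
  also have "\<dots> = (\<Sum>p\<in>{2..n} \<times> {1..l}. \<Sum>i\<in>?I (fst p). ?t (fst p) i * ln (real (fst p)))"
  proof (rule sum.cong)
    fix p assume "p \<in> {2..n} \<times> {1..l}"
    then have "real (card {S \<in> ?F. p \<in> S}) = (\<Sum>i\<in>?I (fst p). ?t (fst p) i)"
      using card_factorizations_containing[of "fst p" "snd p" l n k] assms
      by (auto simp: colored_parts_def)
    then show "(\<Sum>S | S \<in> ?F \<and> p \<in> S. ln (real (fst p))) =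
        (\<Sum>i\<in>?I (fst p). ?t (fst p) i * ln (real (fst p)))"
      by (simp add: sum_distrib_right)
  qed simp
  also have "\<dots> = (\<Sum>d\<in>{2..n}. \<Sum>c\<in>{1..l}. \<Sum>i\<in>?I d. ?t d i * ln (real d))"
    using sum.cartesian_product[of "\<lambda>d c. \<Sum>i\<in>?I d. ?t d i * ln (real d)" "{1..l}" "{2..n}"]
    by (simp only: case_prod_unfold)
  also have "\<dots> = real l * (\<Sum>d\<in>{2..n}. \<Sum>i\<in>?I d. ?t d i * ln (real d))"
    by (simp add: sum_distrib_left)
  also have "(\<Sum>d\<in>{2..n}. \<Sum>i\<in>?I d. ?t d i * ln (real d)) =
      (\<Sum>(d, i) \<in> Sigma {2..n} ?I. ?t d i * ln (real d))"
    by (intro sum.Sigma) (auto intro: finite_subset[of _ "{..k}"])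
  also have "Sigma {2..n} ?I = {(d, i). 2 \<le> d \<and> 1 \<le> i \<and> i \<le> k \<and> d ^ i dvd n}"
  proof -
    have "d \<le> n" if "1 \<le> i" "d ^ i dvd n" for d i
    proof -
      have "d dvd n"
        using that dvd_trans[OF dvd_power[of i d]] by simp
      then show ?thesis
        using assms by (intro dvd_imp_le) auto
    qed
    then show ?thesis
      by auto
  qed
  finally show ?thesis .
qed

lemma g_recursion_g_distinct: "g_recursion l (\<lambda>k m. real (g_distinct k l m))"
  unfolding g_recursion_def
proof (intro conjI allI impI)
  show "real (g_distinct 0 l 1) = 1"
    by (simp only: g_distinct_eq_card distinct_factorizations_0_1) simp
  show "real (g_distinct k l 1) = 0" if "k \<ge> 1" for k
    by (simp only: g_distinct_eq_card distinct_factorizations_Suc_1[OF that]) simp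
  show "real (g_distinct 0 l n) = 0" if "n \<ge> 2" for n
    by (simp add: g_distinct_eq_card distinct_factorizations_0[OF that])
qed (rule g_distinct_times_ln, simp)

lemma g_recursion_unique:
  assumes "g_recursion l h" "g_recursion l h'" "m \<ge> 1"
  shows "h k m = h' k m"
  using \<open>m \<ge> 1\<close>
proof (induction m arbitrary: k rule: less_induct)
  case (less m)
  consider "m = 1" | "m \<ge> 2" "k = 0" | "m \<ge> 2" "k \<ge> 1"
    using less.prems by linarith
  then show ?case
  proof cases
    case 1
    then show ?thesis
      using assms(1,2) by (cases "k = 0") (auto simp: g_recursion_def)
  next
    case 2
    then show ?thesis
      using assms(1,2) by (simp add: g_recursion_def)
  next
    case 3
    let ?D = "{(d, i). 2 \<le> d \<and> 1 \<le> i \<and> i \<le> k \<and> d ^ i dvd m}"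
    let ?rhs = "\<lambda>h. real l * (\<Sum>(d, i) \<in> ?D.
      (-1) ^ (i + 1) * h (k - i) (m div d ^ i) * ln (real d))"
    have eq: "h (k - i) (m div d ^ i) = h' (k - i) (m div d ^ i)" if "(d, i) \<in> ?D" for d i
    proof (rule less.IH)
      have "d ^ i > 1"
        using that by (intro one_less_power) auto
      then show "m div d ^ i < m"
        using less.prems by (intro div_less_dividend) auto
      have "d ^ i \<le> m"
        using that less.prems by (auto intro: dvd_imp_le)
      then show "m div d ^ i \<ge> 1"
        using \<open>d ^ i > 1\<close> by (metis Suc_le_eq One_nat_def div_greater_zero_iff less_trans zero_less_one)
    qed
    have "?rhs h = ?rhs h'"
      using eq by (intro arg_cong[where f = "(*) (real l)"] sum.cong) auto
    then have "h k m * ln (real m) = h' k m * ln (real m)"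
      using assms(1,2) 3 by (simp add: g_recursion_def)
    then show ?thesis
      using 3 by simp
  qed
qed

theorem theorem11:
  fixes n l :: nat
  assumes "n \<ge> 2" and "l \<ge> 1"
  shows "B_distinct l n = (\<Sum>k = 1..bigomega n. fact k * g_distinct k l n) \<and>
         g_recursion l (\<lambda>k m. real (g_distinct k l m)) \<and>
         (\<forall>h. g_recursion l h \<longrightarrow> (\<forall>k. \<forall>m\<ge>1. h k m = real (g_distinct k l m)))"
  using B_distinct_eq_sum_fact[OF assms(1)] g_recursion_g_distinct
    g_recursion_unique[OF _ g_recursion_g_distinct]
  by blast

end
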